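(* Let $0\le n\le 12$ and consider the open-chain resolution $\rho:\mathcal{Y}\to D$ of a Class 1--4 horizontal model over the Hirzebruch surface $\mathbb{F}_n$. Let $Y_0=\bigcup_{p=0}^{P}Y^p$ be its central fiber, with generic (codimension-zero) elliptic fibers of Kodaira type $\mathrm{I}_{n_0},\dots,\mathrm{I}_{n_P}$ over the base components $B^0,\dots,B^P$, and suppose that $(P,n_0)\neq(0,0)$. Then the model is of exactly one of the following four types: (II.a) $P\ge 1$ and $n_p=0$ for all $p\in\{0,\dots,P\}$; (II.b) $P=0$ and $n_0>0$; (III.a) $P\ge1$, $n_p>0$ for all $p\in\{1,\dots,P-1\}$, at least one of $n_0,n_P$ equals $0$, and not all of $n_0,\dots,n_P$ are $0$; (III.b) $P\ge 1$ and $n_p>0$ for all $p\in\{0,\dots,P\}$.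
   Context: All varieties are over $\mathbb{C}$ and $D\subset\mathbb{C}$ is an open disk with coordinate $u$. The Hirzebruch surface $\mathbb{F}_n$ is a $\mathbb{P}^1$-bundle over $\mathbb{P}^1$, with fiber class $f$, a section $h$ with $h\cdot h=-n$, $h\cdot f=1$, and sections in the class $h+nf$ (self-intersection $+n$). A horizontal model over $\mathbb{F}_n$ is a degeneration $\hat\rho:\hat{\mathcal{Y}}\to D$ of Calabi-Yau threefolds given by a Weierstrass model $y^2=x^3+fxz^4+gz^6$ over $\hat{\mathcal{B}}=\mathbb{F}_n\times D$, with discriminant $\Delta=4f^3+27g^2$, such that the non-minimal elliptic fibers in codimension one of the central base $\mathbb{F}_n\times\{0\}$ (vanishing orders of $(f,g,\Delta)$ at least $(4,6,12)$) lie over $h$, over a curve in the class $h+nf$, or over both (or there are none, in which case $P=0$ below). It is of Class 1--4 if along each non-minimal curve the orders of vanishing on the family satisfy $\mathrm{ord}(f)\le 4$ or $\mathrm{ord}(g)\le 6$ (i.e. the non-minimality bound is saturated by at least one of them). Its open-chain resolution $\rho:\mathcal{Y}\to D$ is obtained by base change $u\mapsto u^k$, successive blow-ups of the base along the non-minimal curves, and division of $(f,g,\Delta)$ by the appropriate powers $(4,6,12)$ of the exceptional coordinates. It is a Weierstrass model with polynomials $f,g,\Delta$ over a smooth threefold $\mathcal{B}$ fibered over $D$, with the following properties. (1) The fiber of $\mathcal{B}$ over $0$ is a reduced chain $B_0=\bigcup_{p=0}^P B^p$ with $B^p\cong\mathbb{F}_n$. Write $S_p$, $T_p=S_p+nV_p$,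 $V_p$ for the classes of the $(-n)$-curve, the $(+n)$-curves and the fiber in $B^p$. For $0\le p\le P-1$, $B^p\cap B^{p+1}$ is the $(-n)$-curve in $B^p$ and a $(+n)$-curve in $B^{p+1}$; non-adjacent components are disjoint. (2) Let $f_p=f|_{B^p}$ and $g_p=g|_{B^p}$. These are sections of $\mathcal{L}_p^{\otimes4}$ and $\mathcal{L}_p^{\otimes6}$, where for $P\ge1$: $\mathcal{L}_0=S_0+(2+n)V_0$, $\mathcal{L}_p=2V_p$ for $1\le p\le P-1$, and $\mathcal{L}_P=S_P+2V_P$; for $P=0$: $\mathcal{L}_0=2S_0+(2+n)V_0$. The elliptic fiber over the generic point of $B^p$ is of Kodaira type $\mathrm{I}_{n_p}$ with $n_p\ge 0$: $\Delta$ vanishes to order exactly $n_p$ along $B^p$, and if $n_p>0$ then neither $f_p$ nor $g_p$ is identically zero. (3) The modified discriminant is the effective divisor $\Delta'=\mathrm{div}(\Delta)-\sum_{p}n_pB^p$, which contains no $B^p$. Its restrictions $\Delta'_p=\Delta'|_{B^p}$ are effective divisors, whose classes for $P\ge 1$ are $\Delta'_0=(12+n_0-n_1)S_0+(24+12n)V_0$, $\Delta'_p=(2n_p-n_{p-1}-n_{p+1})S_p+(24+n(n_p-n_{p-1}))V_p$ for $1\le p\le P-1$, $\Delta'_P=(12+n_P-n_{P-1})S_P+(24+n(n_P-n_{P-1}))V_P$. The excluded case $P=0$, $n_0=0$ is the finite-distance (Type I) case. *)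

theory Defs
  imports "HOL-Complex_Analysis.Complex_Analysis" "HOL-Library.Extended_Nat"
begin

text \<open>
  The bases occurring here are smooth toric varieties relative to the disk, and are handled through
  homogeneous (Cox) coordinates: such a base is the quotient of an open set \<open>cox_space\<close> by a free
  action of an algebraic torus \<open>torus\<close>, and a section of the line bundle attached to a character
  \<open>\<kappa>\<close> of the torus is a holomorphic function that is \<open>\<kappa>\<close>-equivariant.  The base of chain length
  \<open>P\<close> has coordinates

  \<^item> \<open>Cs\<close>, \<open>Ct\<close>: the homogeneous coordinates of the base line (fiber class \<open>V\<close>);
  \<^item> \<open>Cz\<close>, \<open>Cw\<close>: the sections at the two ends of the chain;
  \<^item> \<open>Ce p\<close> for \<open>p \<le> P\<close>: the equation of the component \<open>B^p\<close> of the central fiber, where the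
    coordinate of the disk is \<open>u = (\<Prod>p\<le>P. Ce p)\<close>.

  For \<open>P = 0\<close> the space is the product of the Hirzebruch surface \<open>F_n\<close> and the disk:
  \<open>Ce 0\<close> is \<open>u\<close>, and \<open>Cz = 0\<close>, \<open>Cw = 0\<close> are a \<open>(-n)\<close>-curve and a \<open>(+n)\<close>-curve of \<open>F_n\<close>,
  with weights \<open>\<mu>\<close> and \<open>\<lambda>^n \<mu>\<close> under \<open>(\<lambda>, \<mu>)\<close>.
\<close>

datatype coord = Cs | Ct | Cz | Cw | Ce nat

type_synonym pt = "coord \<Rightarrow> complex"

definition coords :: "nat \<Rightarrow> coord set" where
  "coords P = {Cs, Ct, Cz, Cw} \<union> Ce ` {..P}"

text \<open>
  In the (fiber, disk) plane the rays of the fan are \<open>(-1,0)\<close> for \<open>Cw\<close>, \<open>(p,1)\<close> for \<open>Ce p\<close> and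
  \<open>(1,0)\<close> for \<open>Cz\<close>; \<open>ray P i\<close> lists them in cyclic order, \<open>i \<le> P + 2\<close>.  Divisors of
  non-neighbouring rays are disjoint.
\<close>

definition ray :: "nat \<Rightarrow> nat \<Rightarrow> coord" where
  "ray P i = (if i = 0 then Cw else if i \<le> P + 1 then Ce (i - 1) else Cz)"

definition cox_space :: "nat \<Rightarrow> complex set \<Rightarrow> pt set" where
  "cox_space P D =
     {x. (\<forall>c. c \<notin> coords P \<longrightarrow> x c = 0) \<and>
         (x Cs \<noteq> 0 \<or> x Ct \<noteq> 0) \<and>
         (\<forall>i j. i + 1 < j \<and> j \<le> P + 2 \<longrightarrow> x (ray P i) \<noteq> 0 \<or> x (ray P j) \<noteq> 0) \<and>
         (\<Prod>p\<le>P. x (Ce p)) \<in> D}"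

text \<open>
  The torus fixes the rational function \<open>Cz * (\<Prod>p\<le>P. Ce p ^ p) * Cs ^ n / Cw\<close>, so that on \<open>B^p\<close>
  the curve cut out by the next coordinate (\<open>Ce (p + 1)\<close>, or \<open>Cz\<close> if \<open>p = P\<close>) is the
  \<open>(-n)\<close>-curve and the one cut out by the previous coordinate (\<open>Ce (p - 1)\<close>, or \<open>Cw\<close> if
  \<open>p = 0\<close>) is a \<open>(+n)\<close>-curve.
\<close>

definition torus :: "nat \<Rightarrow> nat \<Rightarrow> pt set" where
  "torus n P =
     {\<alpha>. (\<forall>c. \<alpha> c \<noteq> 0) \<and> \<alpha> Ct = \<alpha> Cs \<and>
         (\<Prod>p\<le>P. \<alpha> (Ce p)) = 1 \<and>
         \<alpha> Cw = \<alpha> Cs ^ n * \<alpha> Cz * (\<Prod>p\<le>P. \<alpha> (Ce p) ^ p)}"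

definition component :: "nat \<Rightarrow> complex set \<Rightarrow> nat \<Rightarrow> pt set" where
  "component P D p = {x \<in> cox_space P D. x (Ce p) = 0}"

text \<open>Holomorphic in the coordinates \<open>I\<close>: continuous and holomorphic in each coordinate (Osgood).\<close>

definition holomorphic_in :: "coord set \<Rightarrow> pt set \<Rightarrow> (pt \<Rightarrow> complex) \<Rightarrow> bool" where
  "holomorphic_in I U F \<longleftrightarrow>
     continuous_on U F \<and>
     (\<forall>x\<in>U. \<forall>c\<in>I. (\<lambda>\<zeta>. F (x(c := \<zeta>))) holomorphic_on {\<zeta>. x(c := \<zeta>) \<in> U})"

definition is_section ::
  "coord set \<Rightarrow> pt set \<Rightarrow> pt set \<Rightarrow> (pt \<Rightarrow> complex) \<Rightarrow> (pt \<Rightarrow> complex) \<Rightarrow> bool" where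
  "is_section I U G \<kappa> F \<longleftrightarrow>
     holomorphic_in I U F \<and> (\<forall>\<alpha>\<in>G. \<forall>x\<in>U. F (\<lambda>c. \<alpha> c * x c) = \<kappa> \<alpha> * F x)"

text \<open>
  The Weierstrass line bundle.  For \<open>P = 0\<close> it is the anticanonical bundle \<open>2h + (2 + n)f\<close> of
  \<open>F_n\<close>.  For \<open>P \<ge> 1\<close> the coordinate \<open>Cw\<close> vanishes only on \<open>B^0\<close> and \<open>Cz\<close> only on \<open>B^P\<close> within
  the central fiber, so its restrictions are \<open>S_0 + (2 + n)V_0\<close>, \<open>2V_p\<close> and \<open>S_P + 2V_P\<close>.
\<close>

definition weierstrass_char :: "pt \<Rightarrow> complex" where
  "weierstrass_char \<alpha> = \<alpha> Cs * \<alpha> Ct * \<alpha> Cz * \<alpha> Cw"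

definition disc :: "(pt \<Rightarrow> complex) \<Rightarrow> (pt \<Rightarrow> complex) \<Rightarrow> pt \<Rightarrow> complex" where
  "disc f g x = 4 * f x ^ 3 + 27 * g x ^ 2"

definition weierstrass_model ::
  "nat \<Rightarrow> nat \<Rightarrow> complex set \<Rightarrow> (pt \<Rightarrow> complex) \<Rightarrow> (pt \<Rightarrow> complex) \<Rightarrow> bool" where
  "weierstrass_model n P D f g \<longleftrightarrow>
     is_section (coords P) (cox_space P D) (torus n P) (\<lambda>\<alpha>. weierstrass_char \<alpha> ^ 4) f \<and>
     is_section (coords P) (cox_space P D) (torus n P) (\<lambda>\<alpha>. weierstrass_char \<alpha> ^ 6) g \<and>
     (\<exists>x\<in>cox_space P D. disc f g x \<noteq> 0)"

text \<open>
  Orders of vanishing.  The multiplicity at a point is tested on all lines through it; the order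
  along a locus is the minimum of the multiplicities at its points.  The torus acts freely, so these
  multiplicities agree with those on the quotient.
\<close>

definition multiplicity_ge ::
  "coord set \<Rightarrow> (pt \<Rightarrow> complex) \<Rightarrow> pt \<Rightarrow> nat \<Rightarrow> bool" where
  "multiplicity_ge I F x m \<longleftrightarrow>
     (\<forall>v. (\<forall>c. c \<notin> I \<longrightarrow> v c = 0) \<longrightarrow>
       (\<forall>j<m. (deriv ^^ j) (\<lambda>\<tau>. F (\<lambda>c. x c + \<tau> * v c)) 0 = 0))"

definition vanishing_order ::
  "coord set \<Rightarrow> pt set \<Rightarrow> (pt \<Rightarrow> complex) \<Rightarrow> enat" where
  "vanishing_order I C F = Sup {enat m | m. \<forall>x\<in>C. multiplicity_ge I F x m}"

definition non_minimal ::
  "coord set \<Rightarrow> pt set \<Rightarrow> (pt \<Rightarrow> complex) \<Rightarrow> (pt \<Rightarrow> complex) \<Rightarrow> bool" where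
  "non_minimal I C f g \<longleftrightarrow>
     vanishing_order I C f \<ge> 4 \<and> vanishing_order I C g \<ge> 6 \<and>
     vanishing_order I C (disc f g) \<ge> 12"

text \<open>
  A (possibly reducible) curve in \<open>B^p\<close>: the zero set of a nonzero section of a line bundle.
\<close>

definition curve_in :: "nat \<Rightarrow> nat \<Rightarrow> complex set \<Rightarrow> nat \<Rightarrow> pt set \<Rightarrow> bool" where
  "curve_in n P D p C \<longleftrightarrow>
     (\<exists>(a :: coord \<Rightarrow> int) F.
        is_section (coords P - {Ce p}) (component P D p) (torus n P)
          (\<lambda>\<alpha>. \<Prod>c\<in>coords P. \<alpha> c powi a c) F \<and>
        (\<exists>x\<in>component P D p. F x \<noteq> 0) \<and>
        C = {x \<in> component P D p. F x = 0} \<and> C \<noteq> {})"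

text \<open>
  The fiber over \<open>u \<noteq> 0\<close> of a degeneration of Calabi-Yau threefolds: the Weierstrass bundle is the
  anticanonical bundle, and the Weierstrass model over \<open>F_n \<times> {u}\<close> is nondegenerate and minimal
  along every curve.  The directions along \<open>Ce 0\<close> are dropped since \<open>u\<close> is fixed.
\<close>

definition calabi_yau_fiber ::
  "nat \<Rightarrow> complex set \<Rightarrow> (pt \<Rightarrow> complex) \<Rightarrow> (pt \<Rightarrow> complex) \<Rightarrow> complex \<Rightarrow> bool" where
  "calabi_yau_fiber n D f g u \<longleftrightarrow>
     (\<exists>x\<in>cox_space 0 D. x (Ce 0) = u \<and> disc f g x \<noteq> 0) \<and>
     (\<forall>C. curve_in n 0 D 0 C \<longrightarrow>
        \<not> non_minimal (coords 0 - {Ce 0}) ((\<lambda>x. x(Ce 0 := u)) ` C) f g)"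

definition curve_h :: "complex set \<Rightarrow> pt set" where
  "curve_h D = {x \<in> component 0 D 0. x Cz = 0}"

definition curve_plus :: "complex set \<Rightarrow> (pt \<Rightarrow> complex) \<Rightarrow> pt set" where
  "curve_plus D q = {x \<in> component 0 D 0. q x = 0}"

text \<open>
  A member of \<open>|h + nf|\<close> different from \<open>h\<close> is an irreducible section exactly if it is disjoint
  from \<open>h\<close>; this is the condition on \<open>q\<close>.  If no non-minimal curve of class \<open>h + nf\<close> occurs, any
  such \<open>q\<close> may be taken.
\<close>

definition horizontal_model ::
  "nat \<Rightarrow> complex set \<Rightarrow> (pt \<Rightarrow> complex) \<Rightarrow> (pt \<Rightarrow> complex) \<Rightarrow> (pt \<Rightarrow> complex) \<Rightarrow> bool" where
  "horizontal_model n D f g q \<longleftrightarrow>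
     weierstrass_model n 0 D f g \<and>
     (\<forall>u\<in>D - {0}. calabi_yau_fiber n D f g u) \<and>
     is_section (coords 0 - {Ce 0}) (component 0 D 0) (torus n 0) (\<lambda>\<alpha>. \<alpha> Cw) q \<and>
     curve_h D \<inter> curve_plus D q = {} \<and>
     (\<forall>C. curve_in n 0 D 0 C \<and> non_minimal (coords 0) C f g \<longrightarrow> C \<subseteq> curve_h D \<union> curve_plus D q)"

definition class_1_to_4 ::
  "nat \<Rightarrow> complex set \<Rightarrow> (pt \<Rightarrow> complex) \<Rightarrow> (pt \<Rightarrow> complex) \<Rightarrow> bool" where
  "class_1_to_4 n D f g \<longleftrightarrow>
     (\<forall>C. curve_in n 0 D 0 C \<and> non_minimal (coords 0) C f g \<longrightarrow>
        vanishing_order (coords 0) C f \<le> 4 \<or> vanishing_order (coords 0) C g \<le> 6)"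

definition base_change :: "complex set \<Rightarrow> nat \<Rightarrow> complex set" where
  "base_change D k = {u. u ^ k \<in> D}"

text \<open>
  The blow-down from the chain of length \<open>P\<close> to \<open>F_n\<close> times the disk, as a relation between
  homogeneous coordinates \<open>x\<close> below and \<open>y\<close> above.  The component \<open>B^m\<close> is the strict transform of
  the original central fiber, \<open>B^(m+1), \<dots>, B^P\<close> arise by blowing up successively along
  \<open>Z = u = 0\<close> and \<open>B^(m-1), \<dots>, B^0\<close> along \<open>W = u = 0\<close>; exponents use truncated subtraction.
  A blow-up center after the first one is a section of the last exceptional component disjoint from
  the previous components; allowing the equations \<open>Z\<close>, \<open>W\<close> to depend on \<open>u\<close> covers all choices.
\<close>

definition blow_down ::
  "nat \<Rightarrow> nat \<Rightarrow> (pt \<Rightarrow> complex) \<Rightarrow> (pt \<Rightarrow> complex) \<Rightarrow> pt \<Rightarrow> pt \<Rightarrow> bool" where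
  "blow_down P m Z W x y \<longleftrightarrow>
     x Cs = y Cs \<and> x Ct = y Ct \<and> x (Ce 0) = (\<Prod>p\<le>P. y (Ce p)) \<and>
     Z x = y Cz * (\<Prod>p\<le>P. y (Ce p) ^ (p - m)) \<and>
     W x = y Cw * (\<Prod>p\<le>P. y (Ce p) ^ (m - p))"

text \<open>
  Dividing by the fourth (sixth) power of an exceptional coordinate is possible exactly if the center
  of the corresponding blow-up is non-minimal; in total the coordinate of \<open>B^p\<close> is divided out
  \<open>4 * \<bar>p - m\<bar>\<close> resp. \<open>6 * \<bar>p - m\<bar>\<close> times.  The last condition says that the process has been
  carried to its end.
\<close>

definition open_chain_resolution ::
  "nat \<Rightarrow> complex set \<Rightarrow> (pt \<Rightarrow> complex) \<Rightarrow> (pt \<Rightarrow> complex) \<Rightarrow> (pt \<Rightarrow> complex) \<Rightarrow>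
   nat \<Rightarrow> nat \<Rightarrow> nat \<Rightarrow> (pt \<Rightarrow> complex) \<Rightarrow> (pt \<Rightarrow> complex) \<Rightarrow>
   (pt \<Rightarrow> complex) \<Rightarrow> (pt \<Rightarrow> complex) \<Rightarrow> bool" where
  "open_chain_resolution n D fh gh q k P m Z W f g \<longleftrightarrow>
     k \<ge> 1 \<and> m \<le> P \<and>
     is_section (coords 0) (cox_space 0 (base_change D k)) (torus n 0) (\<lambda>\<alpha>. \<alpha> Cz) Z \<and>
     is_section (coords 0) (cox_space 0 (base_change D k)) (torus n 0) (\<lambda>\<alpha>. \<alpha> Cw) W \<and>
     (\<forall>x\<in>cox_space 0 (base_change D k). Z x \<noteq> 0 \<or> W x \<noteq> 0) \<and>
     {x \<in> component 0 (base_change D k) 0. Z x = 0} = curve_h D \<and>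
     {x \<in> component 0 (base_change D k) 0. W x = 0} = curve_plus D q \<and>
     ((\<forall>C. curve_in n 0 D 0 C \<longrightarrow> \<not> non_minimal (coords 0) C fh gh) \<longrightarrow> P = 0) \<and>
     weierstrass_model n P (base_change D k) f g \<and>
     (\<forall>x\<in>cox_space 0 (base_change D k). \<forall>y\<in>cox_space P (base_change D k).
        blow_down P m Z W x y \<longrightarrow>
          fh (x(Ce 0 := x (Ce 0) ^ k)) = (\<Prod>p\<le>P. y (Ce p) ^ (4 * ((p - m) + (m - p)))) * f y \<and>
          gh (x(Ce 0 := x (Ce 0) ^ k)) = (\<Prod>p\<le>P. y (Ce p) ^ (6 * ((p - m) + (m - p)))) * g y) \<and>
     (\<forall>p\<le>P. \<forall>C. curve_in n P (base_change D k) p C \<longrightarrow> \<not> non_minimal (coords P) C f g)"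

text \<open>Kodaira type \<open>I_\<nu>\<close> over the generic point of \<open>B^p\<close>.\<close>

definition generic_fiber_type_I ::
  "nat \<Rightarrow> complex set \<Rightarrow> (pt \<Rightarrow> complex) \<Rightarrow> (pt \<Rightarrow> complex) \<Rightarrow> nat \<Rightarrow> nat \<Rightarrow> bool" where
  "generic_fiber_type_I P D f g p \<nu> \<longleftrightarrow>
     vanishing_order (coords P) (component P D p) (disc f g) = enat \<nu> \<and>
     (\<nu> > 0 \<longrightarrow> (\<exists>x\<in>component P D p. f x \<noteq> 0) \<and> (\<exists>x\<in>component P D p. g x \<noteq> 0))"

datatype limit_type = II_a | II_b | III_a | III_b

fun has_limit_type :: "nat \<Rightarrow> (nat \<Rightarrow> nat) \<Rightarrow> limit_type \<Rightarrow> bool" where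
  "has_limit_type P \<nu> II_a \<longleftrightarrow> P \<ge> 1 \<and> (\<forall>p\<in>{0..P}. \<nu> p = 0)"
| "has_limit_type P \<nu> II_b \<longleftrightarrow> P = 0 \<and> \<nu> 0 > 0"
| "has_limit_type P \<nu> III_a \<longleftrightarrow>
     P \<ge> 1 \<and> (\<forall>p. 1 \<le> p \<and> p < P \<longrightarrow> \<nu> p > 0) \<and> (\<nu> 0 = 0 \<or> \<nu> P = 0) \<and>
     \<not> (\<forall>p\<in>{0..P}. \<nu> p = 0)"
| "has_limit_type P \<nu> III_b \<longleftrightarrow> P \<ge> 1 \<and> (\<forall>p\<in>{0..P}. \<nu> p > 0)"

end

(*
  On an interior component B^p the Weierstrass line bundle is pulled back from the base line, so f, g
  and hence the discriminant are constant along the rulings of B^p.  If the discriminant does not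
  vanish identically on B^p, it therefore does not vanish identically on the two curves in which B^p
  meets its neighbours: nu p = 0 forces nu (p - 1) = nu (p + 1) = 0.  So a zero of nu at an interior
  place spreads over the whole chain.
*)
theory Submission
  imports Defs
begin

section \<open>Functions on the projective line\<close>

text \<open>Two charts of the projective line: continuity of \<open>k\<close> at 0 gives
  \<open>h\<close> a finite limit at infinity, so Liouville's theorem applies.\<close>

lemma entire_inversion_eq_const:
  fixes h k :: "complex \<Rightarrow> complex"
  assumes h: "h holomorphic_on UNIV" and k: "k holomorphic_on UNIV"
    and hk: "\<And>z. z \<noteq> 0 \<Longrightarrow> h z = k (inverse z)"
  shows "h z = k 0"
proof -
  have "isCont k 0"
    using holomorphic_on_imp_continuous_on[OF k] by (simp add: continuous_on_eq_continuous_at)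
  then have "((\<lambda>z. k (inverse z)) \<longlongrightarrow> k 0) at_infinity"
    by (rule isCont_tendsto_compose) (rule tendsto_inverse_0)
  moreover have "\<forall>\<^sub>F z in at_infinity. k (inverse z) = h z"
    unfolding eventually_at_infinity
  proof (intro exI allI impI)
    fix z :: complex assume "1 \<le> norm z"
    then have "z \<noteq> 0" by auto
    then show "k (inverse z) = h z" by (rule hk[symmetric])
  qed
  ultimately have "(h \<longlongrightarrow> k 0) at_infinity"
    by (rule Lim_transform_eventually)
  with h show ?thesis
    by (rule Liouville_weak)
qed

section \<open>Rulings of the interior components\<close>

text \<open>On the interior component with index \<open>Suc l\<close>, the pair
  \<open>(a, b)\<close> serves as homogeneous coordinates on the ruling through \<open>x\<close>.
  Indexing by \<open>l\<close> avoids truncated subtraction.\<close>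

definition set_neighbours :: "nat \<Rightarrow> pt \<Rightarrow> complex \<Rightarrow> complex \<Rightarrow> pt" where
  "set_neighbours l x a b = x(Ce l := a, Ce (Suc (Suc l)) := b)"

text \<open>The one-parameter subgroup coming from the relation (l,1) + (l+2,1) = 2(l+1,1) between
  three consecutive rays of the fan.\<close>

definition fiber_scaling :: "nat \<Rightarrow> complex \<Rightarrow> pt" where
  "fiber_scaling l t =
     (\<lambda>c. 1)(Ce l := t, Ce (Suc l) := inverse (t ^ 2), Ce (Suc (Suc l)) := t)"

lemma fiber_scaling_in_torus:
  assumes "Suc l < P" "t \<noteq> 0"
  shows "fiber_scaling l t \<in> torus n P"
proof -
  \<comment> \<open>All other coordinates of the element are 1. The two products in
    \<open>torus\<close> are the cases of exponents 1 and \<open>p\<close>, where t has total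
    exponent 1 - 2 + 1 = 0 and l - 2(l+1) + (l+2) = 0.\<close>
  have supp: "(\<Prod>p\<le>P. fiber_scaling l t (Ce p) ^ e p)
      = (\<Prod>p\<in>{l, Suc l, Suc (Suc l)}. fiber_scaling l t (Ce p) ^ e p)" for e
    using assms(1) by (intro prod.mono_neutral_right) (auto simp: fiber_scaling_def)
  have "(\<Prod>p\<le>P. fiber_scaling l t (Ce p)) = 1"
    using supp[of "\<lambda>_. 1"] assms(2) by (simp add: fiber_scaling_def field_simps power2_eq_square)
  moreover have "(\<Prod>p\<le>P. fiber_scaling l t (Ce p) ^ p) = 1"
    using supp[of "\<lambda>p. p"] assms(2)
    by (simp add: fiber_scaling_def field_simps power_mult_distrib power2_eq_square)
  moreover have "fiber_scaling l t c \<noteq> 0" for c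
    using assms(2) by (simp add: fiber_scaling_def fun_upd_def)
  moreover have "fiber_scaling l t c = 1" if "c \<in> {Cs, Ct, Cz, Cw}" for c
    using that by (auto simp: fiber_scaling_def)
  ultimately show ?thesis
    by (simp add: torus_def)
qed

text \<open>The middle factor \<open>inverse (t ^ 2)\<close> acts on a coordinate that is already 0,
  so only the scaling of \<open>(a, b)\<close> remains.\<close>

lemma fiber_scaling_set_neighbours:
  assumes "x (Ce (Suc l)) = 0"
  shows "(\<lambda>c. fiber_scaling l t c * set_neighbours l x a b c) = set_neighbours l x (t * a) (t * b)"
  using assms by (auto simp: fiber_scaling_def set_neighbours_def)

lemma cox_spaceD_ray:
  "x \<in> cox_space P D \<Longrightarrow> i + 1 < j \<Longrightarrow> j \<le> P + 2 \<Longrightarrow> x (ray P i) \<noteq> 0 \<or> x (ray P j) \<noteq> 0"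
  unfolding cox_space_def by blast

lemma ray_Ce: "1 \<le> i \<Longrightarrow> i \<le> P + 1 \<Longrightarrow> ray P i = Ce (i - 1)"
  by (simp add: ray_def)

lemma ray_eq_Ce_iff: "p \<le> P \<Longrightarrow> ray P i = Ce p \<longleftrightarrow> i = p + 1"
  by (auto simp: ray_def)

text \<open>The vanishing of \<open>Ce (Suc l)\<close>, which is ray l+2, forces the coordinates of
  all non-neighbouring rays to be nonzero at \<open>x\<close>. Hence the only condition on
  \<open>a\<close> and \<open>b\<close> comes from the pair of rays l+1 and l+3.\<close>

lemma set_neighbours_in_component:
  assumes l: "Suc l < P" and x: "x \<in> component P D (Suc l)" and ab: "a \<noteq> 0 \<or> b \<noteq> 0"
  shows "set_neighbours l x a b \<in> component P D (Suc l)"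
proof -
  let ?y = "set_neighbours l x a b"
  have x_cox: "x \<in> cox_space P D" and x0: "x (Ce (Suc l)) = 0"
    using x by (simp_all add: component_def)
  have y0: "?y (Ce (Suc l)) = 0"
    using x0 by (simp add: set_neighbours_def)
  have "?y (ray P i) \<noteq> 0 \<or> ?y (ray P j) \<noteq> 0" if ij: "i + 1 < j" "j \<le> P + 2" for i j
  proof (cases "i = l + 1 \<and> j = l + 3")
    case True
    then show ?thesis
      using ab l by (simp add: ray_Ce set_neighbours_def numeral_eq_Suc)
  next
    case False
    have far: "?y (ray P i) \<noteq> 0" if "i < l + 1 \<or> i > l + 3" "i \<le> P + 2" for i
    proof -
      have "ray P (l + 2) = Ce (Suc l)"
        using l by (simp add: ray_Ce)
      then have "x (ray P i) \<noteq> 0"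
        using cox_spaceD_ray[OF x_cox, of i "l + 2"] cox_spaceD_ray[OF x_cox, of "l + 2" i] that l x0
        by auto
      moreover have "ray P i \<noteq> Ce l" "ray P i \<noteq> Ce (Suc (Suc l))"
        using that l by (auto simp: ray_eq_Ce_iff)
      ultimately show ?thesis
        by (simp add: set_neighbours_def)
    qed
    \<comment> \<open>Among l+1, l+2, l+3 the only non-neighbouring pair is the excluded one, so
      some member of the pair lies outside this range.\<close>
    have "i < l + 1 \<or> j > l + 3"
      using False ij by linarith
    then show ?thesis
      using far[of i] far[of j] ij by linarith
  qed
  \<comment> \<open>The disk coordinate is 0 at both points, so it stays in
    \<open>D\<close>.\<close>
  moreover have "(\<Prod>p\<le>P. z (Ce p)) = 0" if "z (Ce (Suc l)) = 0" for z :: pt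
    using that l by (intro prod_zero) (auto intro!: bexI[of _ "Suc l"])
  then have "(\<Prod>p\<le>P. ?y (Ce p)) = (\<Prod>p\<le>P. x (Ce p))"
    using x0 y0 by metis
  moreover have "?y c = 0" if "c \<notin> coords P" for c
  proof -
    have "c \<noteq> Ce l" "c \<noteq> Ce (Suc (Suc l))" "x c = 0"
      using that l x_cox by (auto simp: coords_def cox_space_def)
    then show ?thesis
      by (simp add: set_neighbours_def)
  qed
  moreover have "?y Cs = x Cs" "?y Ct = x Ct"
    by (simp_all add: set_neighbours_def)
  ultimately show ?thesis
    using x_cox y0 unfolding component_def cox_space_def mem_Collect_eq by metis
qed

text \<open>The character involves no \<open>Ce\<close> coordinate, hence is trivial on
  \<open>fiber_scaling\<close>. The section is thus homogeneous of degree 0 in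
  \<open>(a, b)\<close>, a holomorphic function on a projective line.\<close>

lemma section_constant_on_ruling:
  assumes l: "Suc l < P" and x: "x \<in> component P D (Suc l)" and ab: "a \<noteq> 0 \<or> b \<noteq> 0"
    and F: "is_section (coords P) (cox_space P D) (torus n P) (\<lambda>\<alpha>. weierstrass_char \<alpha> ^ d) F"
  shows "F (set_neighbours l x a b) = F (set_neighbours l x 1 0)"
proof -
  let ?G = "\<lambda>a b. F (set_neighbours l x a b)"
  have in_cox: "set_neighbours l x a b \<in> cox_space P D" if "a \<noteq> 0 \<or> b \<noteq> 0" for a b
    using set_neighbours_in_component[OF l x that] by (simp add: component_def)
  have scale: "?G (t * a) (t * b) = ?G a b" if "t \<noteq> 0" "a \<noteq> 0 \<or> b \<noteq> 0" for t a b
  proof -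
    have "x (Ce (Suc l)) = 0"
      using x by (simp add: component_def)
    moreover have "weierstrass_char (fiber_scaling l t) = 1"
      by (simp add: weierstrass_char_def fiber_scaling_def)
    moreover have "F (\<lambda>c. fiber_scaling l t c * set_neighbours l x a b c)
        = weierstrass_char (fiber_scaling l t) ^ d * ?G a b"
      using F fiber_scaling_in_torus[OF l that(1), of n] in_cox[OF that(2)]
      unfolding is_section_def by blast
    ultimately show ?thesis
      by (simp add: fiber_scaling_set_neighbours)
  qed
  have hol: "(\<lambda>\<zeta>. F (y(c := \<zeta>))) holomorphic_on {\<zeta>. y(c := \<zeta>) \<in> cox_space P D}"
    if "y \<in> cox_space P D" "c \<in> coords P" for y c
    using F that unfolding is_section_def holomorphic_in_def by blast
  have upd1: "(set_neighbours l x 0 1)(Ce l := \<zeta>) = set_neighbours l x \<zeta> 1"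
    and upd2: "(set_neighbours l x 1 0)(Ce (Suc (Suc l)) := \<zeta>) = set_neighbours l x 1 \<zeta>" for \<zeta>
    by (auto simp: set_neighbours_def)
  \<comment> \<open>With one homogeneous coordinate equal to 1 the other may be any complex number,
    so both chart functions are entire.\<close>
  have "(\<lambda>\<zeta>. ?G \<zeta> 1) holomorphic_on UNIV"
    using hol[of "set_neighbours l x 0 1" "Ce l"] l by (simp add: upd1 in_cox coords_def)
  moreover have "(\<lambda>\<zeta>. ?G 1 \<zeta>) holomorphic_on UNIV"
    using hol[of "set_neighbours l x 1 0" "Ce (Suc (Suc l))"] l
    by (simp add: upd2 in_cox coords_def)
  moreover have "?G z 1 = ?G 1 (inverse z)" if "z \<noteq> 0" for z
    using scale[of z 1 "inverse z"] that by simp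
  ultimately have const: "?G z 1 = ?G 1 0" for z
    by (rule entire_inversion_eq_const)
  show ?thesis
  proof (cases "b = 0")
    case True
    then show ?thesis
      using scale[of a 1 0] ab by simp
  next
    case False
    then show ?thesis
      using scale[of b "a / b" 1] const[of "a / b"] by simp
  qed
qed

section \<open>Spreading of a nonvanishing discriminant\<close>

text \<open>Multiplicity at least 1 only tests the zeroth derivative, that is, the value of
  \<open>F\<close>; no holomorphy enters.\<close>

lemma vanishing_order_eq_0_iff:
  "vanishing_order I C F = 0 \<longleftrightarrow> (\<exists>x\<in>C. F x \<noteq> 0)"
proof
  assume 0: "vanishing_order I C F = 0"
  show "\<exists>x\<in>C. F x \<noteq> 0"
  proof (rule ccontr)
    assume "\<not> (\<exists>x\<in>C. F x \<noteq> 0)"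
    then have "\<forall>x\<in>C. multiplicity_ge I F x 1"
      by (simp add: multiplicity_ge_def)
    then have "enat 1 \<in> {enat m | m. \<forall>x\<in>C. multiplicity_ge I F x m}"
      by blast
    then have "enat 1 \<le> vanishing_order I C F"
      unfolding vanishing_order_def by (rule Sup_upper)
    with 0 show False
      by (simp add: enat_0_iff)
  qed
next
  assume "\<exists>x\<in>C. F x \<noteq> 0"
  then obtain x where x: "x \<in> C" "F x \<noteq> 0" by blast
  have "m = 0" if "multiplicity_ge I F x m" for m
  proof (rule ccontr)
    assume "m \<noteq> 0"
    \<comment> \<open>The direction 0 and the derivative of order 0 give the value at
      \<open>x\<close>.\<close>
    then have "(deriv ^^ 0) (\<lambda>\<tau>. F (\<lambda>c. x c + \<tau> * 0)) 0 = 0"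
      using that[unfolded multiplicity_ge_def, rule_format, of "\<lambda>_. 0" 0] by simp
    with x show False by simp
  qed
  then have "vanishing_order I C F \<le> 0"
    unfolding vanishing_order_def using x(1) by (intro Sup_least) (auto simp: enat_0_iff)
  then show "vanishing_order I C F = 0" by simp
qed

lemma disc_vanishing_order_0_spreads:
  assumes model: "weierstrass_model n P D f g" and l: "Suc l < P"
    and 0: "vanishing_order I (component P D (Suc l)) (disc f g) = 0"
  shows "vanishing_order I (component P D l) (disc f g) = 0"
    and "vanishing_order I (component P D (Suc (Suc l))) (disc f g) = 0"
proof -
  from 0 obtain x where x: "x \<in> component P D (Suc l)" and nz: "disc f g x \<noteq> 0"
    by (auto simp: vanishing_order_eq_0_iff)
  have const: "disc f g (set_neighbours l x a b) = disc f g (set_neighbours l x 1 0)"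
    if "a \<noteq> 0 \<or> b \<noteq> 0" for a b
    using model section_constant_on_ruling[OF l x that]
    unfolding weierstrass_model_def disc_def by metis
  \<comment> \<open>The point \<open>x\<close> lies on its own ruling, with
    \<open>a = x (Ce l)\<close> and \<open>b = x (Ce (Suc (Suc l)))\<close>; these must not both
    vanish.\<close>
  have "x (ray P (l + 1)) \<noteq> 0 \<or> x (ray P (l + 3)) \<noteq> 0"
    using cox_spaceD_ray[of x P D "l + 1" "l + 3"] x l by (simp add: component_def)
  then have "x (Ce l) \<noteq> 0 \<or> x (Ce (Suc (Suc l))) \<noteq> 0"
    using l by (simp add: ray_def numeral_eq_Suc)
  from const[OF this] nz have nz': "disc f g (set_neighbours l x 1 0) \<noteq> 0"
    by (simp add: set_neighbours_def)
  \<comment> \<open>The points (0,1) and (1,0) of the ruling lie on the previous and the next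
    component.\<close>
  have "set_neighbours l x 0 1 \<in> component P D l"
    using set_neighbours_in_component[OF l x, of 0 1]
    by (auto simp: component_def set_neighbours_def)
  moreover have "set_neighbours l x 1 0 \<in> component P D (Suc (Suc l))"
    using set_neighbours_in_component[OF l x, of 1 0]
    by (auto simp: component_def set_neighbours_def)
  moreover have "disc f g (set_neighbours l x 0 1) \<noteq> 0"
    using nz' const[of 0 1] by simp
  ultimately show "vanishing_order I (component P D l) (disc f g) = 0"
    and "vanishing_order I (component P D (Suc (Suc l))) (disc f g) = 0"
    using nz' unfolding vanishing_order_eq_0_iff by blast+
qed

section \<open>Combinatorics of the chain and classification\<close>

lemma zero_spreads_over_chain:
  fixes \<nu> :: "nat \<Rightarrow> nat"
  assumes step: "\<And>l. Suc l < P \<Longrightarrow> \<nu> (Suc l) = 0 \<Longrightarrow> \<nu> l = 0 \<and> \<nu> (Suc (Suc l)) = 0"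
    and p: "1 \<le> p" "p < P" "\<nu> p = 0" and "j \<le> P"
  shows "\<nu> j = 0"
proof (cases "p \<le> j")
  case True
  then show ?thesis
    using \<open>j \<le> P\<close>
  proof (induction j rule: dec_induct)
    case base
    show ?case by (rule p(3))
  next
    case (step i)
    then show ?case
      \<comment> \<open>Here \<open>i\<close> is interior, as 1 \<le> p \<le> i < P, so
        \<open>i = Suc (i - 1)\<close>.\<close>
      using assms(1)[of "i - 1"] p(1) by simp
  qed
next
  case False
  then have "j \<le> p" by simp
  then show ?thesis
  proof (induction j rule: inc_induct)
    case base
    show ?case by (rule p(3))
  next
    case (step i)
    then show ?case
      using assms(1)[of i] p(2) by simp
  qed
qed

lemma has_limit_type_unique:
  assumes "has_limit_type P \<nu> \<sigma>" "has_limit_type P \<nu> \<tau>"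
  shows "\<sigma> = \<tau>"
proof -
  \<comment> \<open>Type \<open>II_b\<close> is separated by \<open>P = 0\<close>, type
    \<open>III_b\<close> from \<open>II_a\<close> and \<open>III_a\<close> by the values at the two
    ends.\<close>
  have "0 \<in> {0..P}" "P \<in> {0..P}"
    by simp_all
  with assms show ?thesis
    by (cases \<sigma>; cases \<tau>; hypsubst; unfold has_limit_type.simps; metis less_irrefl not_one_le_zero)
qed

theorem mainTheorem1:
  fixes n k P m :: nat and r :: real and \<nu> :: "nat \<Rightarrow> nat"
    and fh gh q Z W f g :: "pt \<Rightarrow> complex"
  assumes "n \<le> 12"
    and "r > 0"
    and "horizontal_model n (ball 0 r) fh gh q"
    and "class_1_to_4 n (ball 0 r) fh gh"
    and "open_chain_resolution n (ball 0 r) fh gh q k P m Z W f g"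
    and "\<forall>p\<le>P. generic_fiber_type_I P (base_change (ball 0 r) k) f g p (\<nu> p)"
    and "(P, \<nu> 0) \<noteq> (0, 0)"
  shows "\<exists>!\<tau>. has_limit_type P \<nu> \<tau>"
proof -
  define D where "D = base_change (ball 0 r) k"
  have model: "weierstrass_model n P D f g"
    using assms(5) by (simp add: open_chain_resolution_def D_def)
  have ord: "vanishing_order (coords P) (component P D p) (disc f g) = enat (\<nu> p)"
    if "p \<le> P" for p
    using assms(6) that by (simp add: generic_fiber_type_I_def D_def)
  have "\<nu> l = 0 \<and> \<nu> (Suc (Suc l)) = 0" if "Suc l < P" "\<nu> (Suc l) = 0" for l
    using disc_vanishing_order_0_spreads[OF model that(1), of "coords P"] that
    by (simp add: ord enat_0_iff)
  then have spread: "\<nu> j = 0" if "1 \<le> p" "p < P" "\<nu> p = 0" "j \<le> P" for p j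
    using zero_spreads_over_chain that by blast
  have "\<exists>\<tau>. has_limit_type P \<nu> \<tau>"
  proof (cases "P = 0")
    case True
    then have "has_limit_type P \<nu> II_b"
      using assms(7) by simp
    then show ?thesis ..
  next
    case False
    consider "\<forall>p\<in>{0..P}. \<nu> p = 0" | "\<forall>p\<in>{0..P}. \<nu> p > 0"
      | "\<not> (\<forall>p\<in>{0..P}. \<nu> p = 0)" "\<not> (\<forall>p\<in>{0..P}. \<nu> p > 0)"
      by blast
    then show ?thesis
    proof cases
      case 1
      with False have "has_limit_type P \<nu> II_a" by simp
      then show ?thesis ..
    next
      case 2
      with False have "has_limit_type P \<nu> III_b" by simp
      then show ?thesis ..
    next
      case 3
      \<comment> \<open>An interior zero would spread to all of the chain, against the first
        assumption of this case.\<close>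
      then have interior: "\<forall>p. 1 \<le> p \<and> p < P \<longrightarrow> \<nu> p > 0"
        using spread by (metis atLeastAtMost_iff gr0I)
      \<comment> \<open>Some zero exists by the second assumption; not being interior, it sits at an
        end.\<close>
      obtain p where "p \<le> P" "\<nu> p = 0"
        using 3(2) by auto
      with interior have "\<nu> 0 = 0 \<or> \<nu> P = 0"
        by (metis One_nat_def Suc_leI gr0I le_neq_implies_less less_numeral_extra(3))
      with False 3(1) interior have "has_limit_type P \<nu> III_a" by simp
      then show ?thesis ..
    qed
  qed
  then show ?thesis
    using has_limit_type_unique by blast
qed

end
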